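(* Let $\varphi:\mathbb R\to\mathbb R$ be real-analytic, non-constant and $1$-periodic, let $0<\mu<1$, let $\lambda\ge2$ be an integer, and let $W(\theta)=\sum_{n=0}^\infty\mu^n\varphi(\lambda^n\theta)$. Let $N\ge1$ be the first integer such that $\mu\lambda^N>1$. If $W$ is not analytic, then there exists $\gamma=\gamma(\varphi,\lambda,\mu)>0$ such that for all sufficiently small $\sigma>0$ and all real polynomials $P$ of degree at most $N-1$, $$\mathrm{Leb}\big(\{\theta\in\mathbb S^1:\ |W(\theta)-P(\theta)|\le\sigma\}\big)\lesssim\sigma^\gamma,$$ uniformly in $P$ (the implied constant and the smallness threshold for $\sigma$ do not depend on $P$).
   Context: $\mathbb S^1=\mathbb R/\mathbb Z$ is identified with $[0,1)$ when evaluating $P$, and $\mathrm{Leb}$ is Lebesgue measure. *)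

theory Defs
  imports "HOL-Analysis.Analysis" "HOL-Computational_Algebra.Polynomial"
begin

(* The library's analytic_on is complex analyticity, so real analyticity is defined by
   local convergent power series expansions. *)
definition real_analytic_on :: "(real \<Rightarrow> real) \<Rightarrow> real set \<Rightarrow> bool"
    (infixl "(real'_analytic'_on)" 50) where
  "f real_analytic_on S \<longleftrightarrow> (\<forall>x\<in>S. \<exists>F. (\<lambda>h. f (x + h)) has_fps_expansion F)"

definition weierstrass_fun :: "(real \<Rightarrow> real) \<Rightarrow> real \<Rightarrow> nat \<Rightarrow> real \<Rightarrow> real" where
  "weierstrass_fun \<phi> \<mu> l \<theta> = (\<Sum>n. \<mu> ^ n * \<phi> (real l ^ n * \<theta>))"

end

theory Submission
  imports Defs "HOL-Complex_Analysis.Complex_Analysis"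
begin

text \<open>
  Write \<open>W\<close> for the Weierstrass function. The proof is a renormalisation argument combined
  with a compactness argument.

  On the \<open>l\<close>-adic interval \<open>{k / l ^ n..(k + 1) / l ^ n}\<close>, parametrised by \<open>(k + y) / l ^ n\<close>, the
  functional equation \<open>W x = \<phi> x + \<mu> * W (l * x)\<close> shows that \<open>\<mu> ^ (- n) * W\<close> is
  \<open>W y\<close> plus the analytic function
  \<open>(\<Sum>i = 1..n. \<mu> ^ (- i) * \<phi> ((k + y) / l ^ i))\<close>. The \<open>j\<close>-th Taylor coefficient of the \<open>i\<close>-th
  summand carries the factor \<open>(\<mu> * l ^ j) ^ (- i)\<close>, so for \<open>j \<ge> N\<close> the Taylor coefficients are bounded
  by \<open>B * R ^ j\<close> uniformly in \<open>n\<close> and \<open>k\<close> (\<open>renormalised_difference\<close>), while the terms of degree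
  below \<open>N\<close> can be absorbed into \<open>P\<close>. Hence, seen at every scale and every place, \<open>W - P\<close>
  is the difference of \<open>W\<close> and a power series whose high coefficients obey one fixed bound.
  Modulo rescaling these power series form a compact family. As \<open>W\<close> is not analytic near some
  interior point of the unit interval, it stays away from all of them by a fixed amount on an interval of
  fixed length (\<open>uniform_gap\<close>).

  Consequently there are \<open>\<tau> > 0\<close> and \<open>m \<ge> 1\<close> such that every \<open>l\<close>-adic interval of level \<open>n\<close> contains one of
  level \<open>n + m\<close> on which \<open>\<bar>W - P\<bar>\<close> exceeds \<open>\<tau> * \<mu> ^ n\<close> (\<open>free_subinterval\<close>). As long as
  \<open>\<sigma> \<le> \<tau> * \<mu> ^ n\<close>, this subinterval misses the sublevel set, which is therefore covered by a
  Cantor-like construction: each refinement by \<open>m\<close> levels multiplies the measure by at most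
  \<open>1 - 1 / l ^ m\<close> (\<open>measure_le_of_missing_digits\<close>). The number of admissible refinements is of order
  \<open>ln (1 / \<sigma>)\<close>, which turns the geometric decay into a power of \<open>\<sigma>\<close>.
\<close>

section \<open>Real power series with uniform coefficient bounds\<close>

text \<open>
  Real analyticity is used only through convergence of the series in a neighbourhood of \<open>0\<close>; in
  this form sums, dilations and limits of coefficients need no formal power series calculus.
\<close>

lemma has_fps_expansion_iff_sums:
  fixes f :: "real \<Rightarrow> real"
  shows "(\<exists>F. f has_fps_expansion F) \<longleftrightarrow>
    (\<exists>c r. 0 < r \<and> (\<forall>h. \<bar>h\<bar> < r \<longrightarrow> (\<lambda>j. c j * h ^ j) sums f h))"
proof (safe)
  fix F assume F: "f has_fps_expansion F"
  then obtain e where e: "0 < e" "\<And>h. \<bar>h\<bar> < e \<Longrightarrow> eval_fps F h = f h"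
    by (auto simp: has_fps_expansion_def eventually_nhds_metric)
  obtain K where K: "0 < K" "ereal K < fps_conv_radius F"
    using F ereal_dense2[of 0 "fps_conv_radius F"] by (auto simp: has_fps_expansion_def zero_ereal_def)
  have "(\<lambda>j. fps_nth F j * h ^ j) sums f h" if "\<bar>h\<bar> < min e K" for h
  proof -
    have "ereal (norm h) < fps_conv_radius F"
      using that K(2) by (simp add: less_trans[OF _ K(2)])
    then show ?thesis
      using sums_eval_fps[of h F] e(2)[of h] that by simp
  qed
  then show "\<exists>c r. 0 < r \<and> (\<forall>h. \<bar>h\<bar> < r \<longrightarrow> (\<lambda>j. c j * h ^ j) sums f h)"
    using e K by (intro exI[of _ "fps_nth F"] exI[of _ "min e K"]) auto
next
  fix c :: "nat \<Rightarrow> real" and r :: real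
  assume r: "0 < r" and s: "\<forall>h. \<bar>h\<bar> < r \<longrightarrow> (\<lambda>j. c j * h ^ j) sums f h"
  have "conv_radius c \<ge> r"
  proof (rule conv_radius_geI_ex')
    fix r' assume "0 < r'" "ereal r' < ereal r"
    then show "summable (\<lambda>n. c n * of_real r' ^ n)"
      using s by (auto simp: sums_iff)
  qed
  then have "0 < fps_conv_radius (Abs_fps c)"
    using r by (simp add: fps_conv_radius_def fps_nth_Abs_fps less_le_trans[of 0 "ereal r"])
  moreover have "eventually (\<lambda>h. eval_fps (Abs_fps c) h = f h) (nhds 0)"
    unfolding eventually_nhds_metric
    using r s by (intro exI[of _ r]) (auto simp: eval_fps_def sums_iff)
  ultimately show "\<exists>F. f has_fps_expansion F"
    by (auto simp: has_fps_expansion_def)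
qed

text \<open>
  Expanding about nearby points with uniform bounds is a re-centring of the series. It is done by
  passing to the complex extension \<open>g\<close> and applying Cauchy's inequality on discs of radius \<open>r / 4\<close>,
  all of which lie in the disc of radius \<open>r / 2\<close> where \<open>g\<close> is bounded.
\<close>

lemma local_power_series_bounds:
  fixes f :: "real \<Rightarrow> real"
  assumes "\<exists>F. (\<lambda>h. f (a + h)) has_fps_expansion F"
  shows "\<exists>d>0. \<exists>M>0. \<exists>R>0. \<forall>x. \<bar>x - a\<bar> < d \<longrightarrow>
    (\<exists>c. (\<forall>j. \<bar>c j\<bar> \<le> M * R ^ j) \<and> (\<forall>h. \<bar>h\<bar> * R < 1 \<longrightarrow> (\<lambda>j. c j * h ^ j) sums f (x + h)))"
proof -
  obtain c r where r: "0 < r" and s: "\<And>h. \<bar>h\<bar> < r \<Longrightarrow> (\<lambda>j. c j * h ^ j) sums f (a + h)"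
    using assms unfolding has_fps_expansion_iff_sums by blast
  define g where "g z = (\<Sum>j. complex_of_real (c j) * z ^ j)" for z
  have gs: "(\<lambda>j. complex_of_real (c j) * z ^ j) sums g z" if "norm z < r" for z
  proof -
    obtain K where K: "norm z < K" "K < r" using \<open>norm z < r\<close> dense by blast
    have "\<bar>K\<bar> < r" using K norm_ge_zero[of z] by linarith
    then have "summable (\<lambda>j. c j * K ^ j)" using s sums_iff by blast
    then have "summable (\<lambda>j. complex_of_real (c j * K ^ j))"
      by (rule summable_of_real)
    then have "summable (\<lambda>j. complex_of_real (c j) * of_real K ^ j)" by simp
    then have "summable (\<lambda>j. complex_of_real (c j) * z ^ j)"
      by (rule powser_inside) (use K norm_ge_zero[of z] in simp)
    then show ?thesis by (simp add: g_def summable_sums)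
  qed
  have ghol: "g holomorphic_on ball 0 r"
    by (rule power_series_holomorphic[of _ _ "\<lambda>j. complex_of_real (c j)"]) (use gs in auto)
  have greal: "g (of_real h) = of_real (f (a + h))" if "\<bar>h\<bar> < r" for h
  proof -
    have "(\<lambda>j. complex_of_real (c j * h ^ j)) sums of_real (f (a + h))"
      using s[OF that] by (rule sums_of_real)
    then show ?thesis using gs[of "of_real h"] that by (simp add: sums_unique2)
  qed
  have "continuous_on (cball 0 (r/2)) g"
    using ghol by (rule holomorphic_on_imp_continuous_on[THEN continuous_on_subset]) (use r in auto)
  then have "compact (g ` cball 0 (r/2))" by (intro compact_continuous_image) auto
  then obtain B where B: "0 < B" "\<And>z. norm z \<le> r/2 \<Longrightarrow> norm (g z) \<le> B"
    by (metis bounded_pos compact_imp_bounded image_eqI mem_cball_0)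
  show ?thesis
  proof (rule exI[of _ "r/4"], rule conjI, goal_cases)
    case 2
    show ?case
    proof (rule exI[of _ B], rule conjI[OF B(1)], rule exI[of _ "4/r"], intro conjI allI impI)
      show "0 < 4/r" using r by auto
      fix x assume x: "\<bar>x - a\<bar> < r/4"
      define y where "y = complex_of_real (x - a)"
      have ny: "norm y < r/4" using x by (simp add: y_def norm_of_real del: of_real_diff)
      have sub: "cball y (r/4) \<subseteq> cball 0 (r/2)"
      proof
        fix z assume "z \<in> cball y (r/4)"
        then have "norm (z - y) \<le> r/4" by (simp add: dist_norm norm_minus_commute)
        then show "z \<in> cball 0 (r/2)" using norm_triangle_ineq[of "z - y" y] ny by simp
      qed
      have sub2: "cball y (r/4) \<subseteq> ball 0 r" using sub r by force
      have hol: "g holomorphic_on ball y (r/4)"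
        by (rule holomorphic_on_subset[OF ghol]) (use sub2 ball_subset_cball in blast)
      have cont: "continuous_on (cball y (r/4)) g"
        by (rule continuous_on_subset[OF holomorphic_on_imp_continuous_on[OF ghol] sub2])
      define d where "d j = Re ((deriv ^^ j) g y / fact j)" for j
      show "\<exists>c. (\<forall>j. \<bar>c j\<bar> \<le> B * (4/r) ^ j) \<and>
          (\<forall>h. \<bar>h\<bar> * (4/r) < 1 \<longrightarrow> (\<lambda>j. c j * h ^ j) sums f (x + h))"
      proof (intro exI[of _ d] conjI allI impI)
        fix j
        have "norm ((deriv ^^ j) g y) \<le> fact j * B / (r/4) ^ j"
        proof (rule Cauchy_inequality[OF hol cont])
          fix z assume "norm (y - z) = r/4"
          then have "z \<in> cball y (r/4)" by (simp add: dist_norm)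
          then show "norm (g z) \<le> B" using sub B(2) by auto
        qed (use r in auto)
        then have "norm ((deriv ^^ j) g y) / fact j \<le> fact j * B / (r/4) ^ j / fact j"
          by (rule divide_right_mono) simp
        then have "norm ((deriv ^^ j) g y / fact j) \<le> B / (r/4) ^ j"
          by (simp add: norm_divide)
        also have "\<dots> = B * (4/r) ^ j" by (simp add: power_divide)
        finally show "\<bar>d j\<bar> \<le> B * (4/r) ^ j"
          unfolding d_def using abs_Re_le_cmod order_trans by blast
      next
        fix h assume "\<bar>h\<bar> * (4/r) < 1"
        then have h: "\<bar>h\<bar> < r/4" using r by (simp add: field_simps)
        have "y + of_real h \<in> ball y (r/4)" using h by (simp add: dist_norm)
        from holomorphic_power_series[OF hol this]
        have "(\<lambda>n. (deriv ^^ n) g y / fact n * (of_real h) ^ n) sums g (y + of_real h)" by simp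
        also have "g (y + of_real h) = g (of_real (x - a + h))" by (simp add: y_def)
        also have "\<dots> = of_real (f (a + (x - a + h)))"
          by (rule greal) (use h x r in linarith)
        also have "a + (x - a + h) = x + h" by simp
        finally have "(\<lambda>n. Re ((deriv ^^ n) g y / fact n * (of_real h) ^ n)) sums f (x + h)"
          using sums_Re by fastforce
        moreover have "Re (X * (of_real h) ^ n) = Re X * h ^ n" for X n
          by (simp flip: of_real_power)
        ultimately show "(\<lambda>j. d j * h ^ j) sums f (x + h)"
          by (simp only: d_def)
      qed
    qed
  qed (use r in simp)
qed

text \<open>
  Compactness of a period turns the local bounds into global ones. The condition
  \<open>\<bar>h\<bar> * R < 1\<close> is the natural domain given the coefficient bound, and it is monotone
  in \<open>R\<close>, so two sets of constants combine by taking maxima.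
\<close>

lemma uniform_power_series_bounds:
  fixes f :: "real \<Rightarrow> real"
  assumes "f real_analytic_on UNIV" and per: "\<And>x. f (x + 1) = f x"
  obtains M R where "0 < M" "0 < R" "\<And>x. \<exists>c. (\<forall>j. \<bar>c j\<bar> \<le> M * R ^ j) \<and>
    (\<forall>h. \<bar>h\<bar> * R < 1 \<longrightarrow> (\<lambda>j. c j * h ^ j) sums f (x + h))"
proof -
  define S where "S x M R \<longleftrightarrow> (\<exists>c. (\<forall>j. \<bar>c j\<bar> \<le> M * R ^ j) \<and>
    (\<forall>h. \<bar>h\<bar> * R < 1 \<longrightarrow> (\<lambda>j. c j * h ^ j) sums f (x + h)))" for x M R :: real
  have mono: "S x M' R'" if "S x M R" "M \<le> M'" "R \<le> R'" "0 < M" "0 < R" for x M R M' R'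
  proof -
    obtain c where c: "\<And>j. \<bar>c j\<bar> \<le> M * R ^ j"
        "\<And>h. \<bar>h\<bar> * R < 1 \<Longrightarrow> (\<lambda>j. c j * h ^ j) sums f (x + h)"
      using \<open>S x M R\<close> unfolding S_def by blast
    have "\<bar>c j\<bar> \<le> M' * R' ^ j" for j
      using that by (intro order_trans[OF c(1)] mult_mono power_mono) auto
    moreover have "\<bar>h\<bar> * R < 1" if "\<bar>h\<bar> * R' < 1" for h
      using that \<open>R \<le> R'\<close> mult_left_mono[of R R' "\<bar>h\<bar>"] by linarith
    ultimately show ?thesis unfolding S_def using c(2) by blast
  qed
  have "\<exists>M>0. \<exists>R>0. \<forall>x\<in>{0..1}. S x M R"
  proof (rule Bolzano[where P="\<lambda>a b. \<exists>M>0. \<exists>R>0. \<forall>x\<in>{a..b}. S x M R"])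
    fix a b c :: real
    assume "\<exists>M>0. \<exists>R>0. \<forall>x\<in>{a..b}. S x M R" "\<exists>M>0. \<exists>R>0. \<forall>x\<in>{b..c}. S x M R"
    then obtain M1 R1 M2 R2 where 1: "0 < M1" "0 < R1" "0 < M2" "0 < R2"
        "\<forall>x\<in>{a..b}. S x M1 R1" "\<forall>x\<in>{b..c}. S x M2 R2" by blast
    have "S x (max M1 M2) (max R1 R2)" if "x \<in> {a..c}" for x
    proof (cases "x \<le> b")
      case True
      then have "S x M1 R1" using 1 that by auto
      then show ?thesis by (rule mono) (use 1 in auto)
    next
      case False
      then have "S x M2 R2" using 1 that by auto
      then show ?thesis by (rule mono) (use 1 in auto)
    qed
    then show "\<exists>M>0. \<exists>R>0. \<forall>x\<in>{a..c}. S x M R"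
      using 1 by (intro exI[of _ "max M1 M2"] conjI exI[of _ "max R1 R2"]) auto
  next
    fix x :: real
    have "\<exists>F. (\<lambda>h. f (x + h)) has_fps_expansion F"
      using assms(1) by (simp add: real_analytic_on_def)
    from local_power_series_bounds[OF this]
    obtain d M R where d: "0 < d" "0 < M" "0 < R" "\<And>y. \<bar>y - x\<bar> < d \<Longrightarrow> S y M R"
      unfolding S_def by blast
    have "\<forall>y\<in>{a..b}. S y M R" if "a \<le> x \<and> x \<le> b \<and> b - a < d" for a b
      using that by (intro ballI d(4)) auto
    then show "\<exists>d>0. \<forall>a b. a \<le> x \<and> x \<le> b \<and> b - a < d \<longrightarrow> (\<exists>M>0. \<exists>R>0. \<forall>x\<in>{a..b}. S x M R)"
      using d by blast
  qed simp
  then obtain M R where MR: "0 < M" "0 < R" "\<And>x. x \<in> {0..1} \<Longrightarrow> S x M R" by blast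
  have "S x M R" for x
  proof -
    interpret periodic_fun_simple' f by standard (rule per)
    have "S (frac x) M R" by (rule MR(3)) (auto simp: frac_lt_1 less_imp_le)
    moreover have "f (frac x + h) = f (x + h)" for h
      using plus_of_int[of "frac x + h" "\<lfloor>x\<rfloor>"] by (simp add: frac_def algebra_simps)
    ultimately show ?thesis unfolding S_def by simp
  qed
  then show ?thesis using that[of M R] MR unfolding S_def by blast
qed

section \<open>A uniform gap to a family of power series\<close>

lemma compact_box_fun:
  fixes K :: "nat \<Rightarrow> real"
  shows "compact {\<beta>. \<forall>j. \<bar>\<beta> j\<bar> \<le> K j}"
proof -
  have "compactin (product_topology (\<lambda>_. euclidean) UNIV) (PiE UNIV (\<lambda>j. {- K j..K j}))"
    unfolding compactin_PiE by simp
  moreover have "PiE UNIV (\<lambda>j. {- K j..K j}) = {\<beta>. \<forall>j. \<bar>\<beta> j\<bar> \<le> K j}"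
    by (simp add: PiE_UNIV_domain Pi_def abs_le_iff minus_le_iff conj_commute)
  ultimately show ?thesis
    by (simp add: euclidean_product_topology)
qed

text \<open>
  The coefficients below \<open>N\<close> are unrestricted, so the family of power series is not compact. Dividing by
  \<open>s = 1 + (\<Sum>j<N. \<bar>b j\<bar>)\<close> restores compactness: the normalised coefficients together with the
  factor \<open>t = 1 / s\<close> in front of \<open>V\<close> lie in a compact subset \<open>K\<close> of the product space, on which
  \<open>t + (\<Sum>j<N. \<bar>\<beta> j\<bar>) = 1\<close>. No \<open>t * V - (\<Sum>j. \<beta> j * h ^ j)\<close> with \<open>(\<beta>, t)\<close> in \<open>K\<close>
  vanishes identically: if \<open>t \<noteq> 0\<close>, then \<open>V\<close> would be analytic, and if \<open>t = 0\<close>, then all \<open>\<beta> j\<close> would be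
  zero, against the normalisation. Compactness gives a lower bound for the maximum over \<open>h\<close>, and uniform
  continuity in all variables jointly spreads it to an interval of fixed length. Since \<open>s \<ge> 1\<close>, undoing
  the normalisation only increases the difference.
\<close>

lemma uniform_gap:
  fixes V :: "real \<Rightarrow> real" and B R r :: real and N :: nat
  assumes pos: "0 < B" "0 < R" "0 < r" "r * R < 1"
    and cont: "continuous_on {-r..r} V"
    and nonanalytic: "\<nexists>F. V has_fps_expansion F"
  obtains \<tau> \<delta> where "0 < \<tau>" "0 < \<delta>"
    "\<And>b. (\<And>j. N \<le> j \<Longrightarrow> \<bar>b j\<bar> \<le> B * R ^ j) \<Longrightarrow>
      \<exists>h0\<in>{-r..r}. \<forall>h\<in>{-r..r}. \<bar>h - h0\<bar> < \<delta> \<longrightarrow> \<tau> < \<bar>V h - (\<Sum>j. b j * h ^ j)\<bar>"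
proof -
  define k where "k j = (if j < N then 1 else B * R ^ j)" for j
  define K where "K = {p :: (nat \<Rightarrow> real) \<times> real.
    p \<in> {\<beta>. \<forall>j. \<bar>\<beta> j\<bar> \<le> k j} \<times> {0..1} \<and> snd p + (\<Sum>j<N. \<bar>fst p j\<bar>) = 1}"
  define f where "f q = snd (fst q) * V (snd q) - (\<Sum>j. fst (fst q) j * snd q ^ j)"
    for q :: "((nat \<Rightarrow> real) \<times> real) \<times> real"
  have coord1: "continuous_on A (\<lambda>p. fst p j)" for A :: "((nat \<Rightarrow> real) \<times> real) set" and j
    by (rule continuous_on_product_then_coordinatewise) (intro continuous_intros)
  have coord2: "continuous_on A (\<lambda>q. fst (fst q) j)" for A :: "(((nat \<Rightarrow> real) \<times> real) \<times> real) set" and j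
    by (rule continuous_on_product_then_coordinatewise) (intro continuous_intros)
  have "compact K"
  proof -
    have "closed {p :: (nat \<Rightarrow> real) \<times> real. snd p + (\<Sum>j<N. \<bar>fst p j\<bar>) = 1}"
      by (intro closed_Collect_eq continuous_intros coord1)
    then have "compact (({\<beta>. \<forall>j. \<bar>\<beta> j\<bar> \<le> k j} \<times> {0..1}) \<inter>
        {p. snd p + (\<Sum>j<N. \<bar>fst p j\<bar>) = 1})"
      by (intro compact_Int_closed compact_Times compact_box_fun compact_Icc)
    then show ?thesis by (simp add: K_def Int_def)
  qed
  have Kbound: "\<bar>fst p j\<bar> \<le> k j" if "p \<in> K" for p j
    using that by (auto simp: K_def)
  have ksum: "summable (\<lambda>j. k j * r ^ j)"
  proof (rule summable_comparison_test_ev)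
    show "eventually (\<lambda>j. norm (k j * r ^ j) \<le> B * (r * R) ^ j) sequentially"
      using eventually_ge_at_top[of N] by eventually_elim (use pos in \<open>auto simp: k_def power_mult_distrib\<close>)
    show "summable (\<lambda>j. B * (r * R) ^ j)"
      using pos by (intro summable_mult summable_geometric) auto
  qed
  have term_le: "norm (fst p j * h ^ j) \<le> k j * r ^ j" if "p \<in> K" "h \<in> {-r..r}" for p h j
    unfolding real_norm_def abs_mult power_abs
    using Kbound[OF that(1), of j] that(2) by (intro mult_mono power_mono) auto
  have sums_K: "(\<lambda>j. fst p j * h ^ j) sums (\<Sum>j. fst p j * h ^ j)" if "p \<in> K" "h \<in> {-r..r}" for p h
    by (rule summable_sums, rule summable_comparison_test'[OF ksum]) (use term_le that in blast)
  have fcont: "continuous_on (K \<times> {-r..r}) f"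
  proof -
    have "uniform_limit (K \<times> {-r..r}) (\<lambda>n q. \<Sum>j<n. fst (fst q) j * snd q ^ j)
        (\<lambda>q. \<Sum>j. fst (fst q) j * snd q ^ j) sequentially"
      by (rule Weierstrass_m_test[OF _ ksum]) (use term_le in auto)
    then have "continuous_on (K \<times> {-r..r}) (\<lambda>q. \<Sum>j. fst (fst q) j * snd q ^ j)"
      by (rule uniform_limit_theorem[rotated])
         (intro always_eventually allI continuous_intros coord2 trivial_limit_sequentially)+
    moreover have "continuous_on (K \<times> {-r..r}) (\<lambda>q. V (snd q))"
      by (rule continuous_on_compose2[OF cont]) (auto intro!: continuous_intros)
    ultimately show ?thesis
      unfolding f_def by (intro continuous_intros)
  qed
  have nonzero: "\<exists>h\<in>{-r..r}. f (p, h) \<noteq> 0" if p: "p \<in> K" for p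
  proof (rule ccontr)
    assume "\<not> (\<exists>h\<in>{-r..r}. f (p, h) \<noteq> 0)"
    then have s: "(\<lambda>j. fst p j * h ^ j) sums (snd p * V h)" if "h \<in> {-r..r}" for h
      using sums_K[OF p that] that by (auto simp: f_def)
    show False
    proof (cases "snd p = 0")
      case False
      have "(\<lambda>j. (fst p j / snd p) * h ^ j) sums V h" if "\<bar>h\<bar> < r" for h
        using sums_mult[OF s[of h], of "1 / snd p"] that False by (simp add: abs_less_iff)
      then have "\<exists>F. V has_fps_expansion F"
        unfolding has_fps_expansion_iff_sums
        using pos(3) by (intro exI[of _ "\<lambda>j. fst p j / snd p"] exI[of _ r]) auto
      then show False using nonanalytic by blast
    next
      case True
      have s0: "(\<lambda>j. fst p j * h ^ j) sums 0" if "\<bar>h\<bar> < r" for h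
        using s[of h] that True by (simp add: abs_less_iff)
      have "fst p j = 0" for j
      proof (rule ccontr)
        assume nz: "fst p j \<noteq> 0"
        have "j > 0"
          using s0[of 0] pos nz by (cases j) (auto simp: sums_unique2)
        obtain u where "0 < u" "\<And>z. z \<in> cball 0 u - {0} \<Longrightarrow> (\<lambda>_::real. 0::real) z \<noteq> 0"
          using powser_0_nonzero[of r 0 "fst p" "\<lambda>_. 0" j] s0 pos nz \<open>j > 0\<close> by (auto simp: mult.commute)
        from this(2)[of u] this(1) show False by simp
      qed
      then show False using p True by (simp add: K_def)
    qed
  qed
  have "\<exists>\<tau>>0. \<forall>p\<in>K. \<exists>h\<in>{-r..r}. 2 * \<tau> \<le> \<bar>f (p, h)\<bar>"
  proof (rule ccontr)
    assume neg: "\<not> ?thesis"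
    have "\<exists>p\<in>K. \<forall>h\<in>{-r..r}. \<bar>f (p, h)\<bar> < 2 * inverse (real (Suc n))" for n
      using neg by (metis inverse_positive_iff_positive of_nat_0_less_iff zero_less_Suc not_le)
    then obtain p where p: "\<And>n. p n \<in> K"
        "\<And>n h. h \<in> {-r..r} \<Longrightarrow> \<bar>f (p n, h)\<bar> < 2 * inverse (real (Suc n))"
      by metis
    obtain l \<rho> where l: "l \<in> K" "strict_mono \<rho>" "(p \<circ> \<rho>) \<longlonglongrightarrow> l"
      using \<open>compact K\<close> p(1) unfolding compact_def by metis
    have "f (l, h) = 0" if h: "h \<in> {-r..r}" for h
    proof -
      have "(\<lambda>n. f ((p \<circ> \<rho>) n, h)) \<longlonglongrightarrow> f (l, h)"
        by (rule continuous_on_tendsto_compose[OF fcont])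
           (use l p h in \<open>auto intro!: tendsto_Pair always_eventually simp: o_def\<close>)
      moreover have "(\<lambda>n. f ((p \<circ> \<rho>) n, h)) \<longlonglongrightarrow> 0"
      proof (rule Lim_null_comparison)
        show "eventually (\<lambda>n. norm (f ((p \<circ> \<rho>) n, h)) \<le> 2 * inverse (real (Suc (\<rho> n)))) sequentially"
          using p(2)[OF h] by (auto intro!: always_eventually less_imp_le)
        have "(\<lambda>n. inverse (real (Suc (\<rho> n)))) \<longlonglongrightarrow> 0"
          using LIMSEQ_subseq_LIMSEQ[OF LIMSEQ_inverse_real_of_nat l(2)] by (simp add: o_def)
        then show "(\<lambda>n. 2 * inverse (real (Suc (\<rho> n)))) \<longlonglongrightarrow> 0"
          by (rule tendsto_mult_right_zero)
      qed
      ultimately show ?thesis by (rule LIMSEQ_unique)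
    qed
    then show False using nonzero[OF l(1)] by blast
  qed
  then obtain \<tau> where \<tau>: "0 < \<tau>" "\<And>p. p \<in> K \<Longrightarrow> \<exists>h\<in>{-r..r}. 2 * \<tau> \<le> \<bar>f (p, h)\<bar>"
    by blast
  have "uniformly_continuous_on (K \<times> {-r..r}) f"
    by (intro compact_uniformly_continuous fcont compact_Times \<open>compact K\<close> compact_Icc)
  then obtain \<delta> where \<delta>: "0 < \<delta>"
      "\<And>q q'. q \<in> K \<times> {-r..r} \<Longrightarrow> q' \<in> K \<times> {-r..r} \<Longrightarrow> dist q' q < \<delta> \<Longrightarrow> dist (f q') (f q) < \<tau>"
    using \<tau>(1) unfolding uniformly_continuous_on_def by metis
  show ?thesis
  proof (rule that[OF \<tau>(1) \<delta>(1)])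
    fix b :: "nat \<Rightarrow> real"
    assume b: "\<And>j. N \<le> j \<Longrightarrow> \<bar>b j\<bar> \<le> B * R ^ j"
    define s where "s = 1 + (\<Sum>j<N. \<bar>b j\<bar>)"
    have s: "1 \<le> s" by (simp add: s_def sum_nonneg)
    define p where "p = ((\<lambda>j. b j / s), 1 / s)"
    have "\<bar>b j / s\<bar> \<le> k j" for j
    proof (cases "j < N")
      case True
      then have "\<bar>b j\<bar> \<le> (\<Sum>j<N. \<bar>b j\<bar>)"
        by (intro member_le_sum) auto
      then show ?thesis using True s by (simp add: k_def s_def)
    next
      case False
      have "\<bar>b j\<bar> / s \<le> \<bar>b j\<bar>" using s by (simp add: divide_le_eq mult_left_le mult_le_cancel_left1)
      then show ?thesis using b[of j] False s by (simp add: k_def)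
    qed
    moreover have "1 / s + (\<Sum>j<N. \<bar>b j / s\<bar>) = 1"
    proof -
      have "1 / s + (\<Sum>j<N. \<bar>b j / s\<bar>) = (1 + (\<Sum>j<N. \<bar>b j\<bar>)) / s"
        using s by (simp add: add_divide_distrib sum_divide_distrib)
      then show ?thesis using s by (simp add: s_def[symmetric])
    qed
    ultimately have pK: "p \<in> K" using s by (simp add: K_def p_def)
    have f_eq: "f (p, h) = (V h - (\<Sum>j. b j * h ^ j)) / s" if "h \<in> {-r..r}" for h
    proof -
      have "(\<lambda>j. (b j / s) * h ^ j) sums (\<Sum>j. (b j / s) * h ^ j)"
        using sums_K[OF pK that] by (simp add: p_def)
      from sums_mult[OF this, of s] have "(\<lambda>j. b j * h ^ j) sums (s * (\<Sum>j. (b j / s) * h ^ j))"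
        using s by simp
      then have "(\<Sum>j. b j * h ^ j) = s * (\<Sum>j. (b j / s) * h ^ j)" by (rule sums_unique[symmetric])
      then show ?thesis using s by (simp add: f_def p_def diff_divide_distrib)
    qed
    obtain h0 where h0: "h0 \<in> {-r..r}" "2 * \<tau> \<le> \<bar>f (p, h0)\<bar>" using \<tau>(2)[OF pK] by blast
    show "\<exists>h0\<in>{-r..r}. \<forall>h\<in>{-r..r}. \<bar>h - h0\<bar> < \<delta> \<longrightarrow> \<tau> < \<bar>V h - (\<Sum>j. b j * h ^ j)\<bar>"
    proof (intro bexI[OF _ h0(1)] ballI impI)
      fix h assume h: "h \<in> {-r..r}" "\<bar>h - h0\<bar> < \<delta>"
      have "dist (f (p, h)) (f (p, h0)) < \<tau>"
        using h h0 pK by (intro \<delta>(2)) (auto simp: dist_Pair_Pair dist_real_def)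
      then have "\<tau> < \<bar>f (p, h)\<bar>" using h0(2) unfolding dist_real_def by linarith
      also have "\<bar>f (p, h)\<bar> \<le> \<bar>V h - (\<Sum>j. b j * h ^ j)\<bar>"
        using s by (simp add: f_eq[OF h(1)] divide_le_eq mult_le_cancel_left1)
      finally show "\<tau> < \<bar>V h - (\<Sum>j. b j * h ^ j)\<bar>" .
    qed
  qed
qed

section \<open>Covering by a Cantor-like construction\<close>

text \<open>
  The interval of level \<open>i\<close> containing \<open>x\<close> is labelled by the integer part of \<open>x * q ^ i\<close>, so
  passing to level \<open>i + 1\<close> appends a base-\<open>q\<close> digit. If after each prefix some digit does not occur in \<open>E\<close>, the
  number of labels grows at most by a factor of \<open>q - 1\<close> per level. The missing digit may depend on the prefix.
\<close>

lemma measure_le_of_missing_digits: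
  fixes E :: "real set" and q J :: nat
  assumes E: "E \<subseteq> {0..<1}" and q: "2 \<le> q"
    and missing: "\<And>i k. i < J \<Longrightarrow> \<exists>j<q. \<forall>x\<in>E. nat \<lfloor>x * real q ^ Suc i\<rfloor> \<noteq> k * q + j"
  shows "measure lebesgue E \<le> (1 - 1 / real q) ^ J"
proof -
  define A where "A i = (\<lambda>x. nat \<lfloor>x * real q ^ i\<rfloor>) ` E" for i
  have card_A: "finite (A i) \<and> card (A i) \<le> (q - 1) ^ i" if "i \<le> J" for i
    using that
  proof (induction i)
    case 0
    have "A 0 \<subseteq> {0}" using E by (auto simp: A_def floor_less_iff)
    then show ?case using card_mono[of "{0}" "A 0"] finite_subset[of "A 0" "{0}"] by simp
  next
    case (Suc i)
    then have fin: "finite (A i)" and ca: "card (A i) \<le> (q - 1) ^ i" by auto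
    obtain d where d: "\<And>k. d k < q" "\<And>k x. x \<in> E \<Longrightarrow> nat \<lfloor>x * real q ^ Suc i\<rfloor> \<noteq> k * q + d k"
      using missing[of i] Suc.prems by (metis Suc_le_eq)
    define T where "T = (SIGMA k:A i. {..<q} - {d k})"
    have sub: "A (Suc i) \<subseteq> (\<lambda>(k, j). k * q + j) ` T"
    proof
      fix a assume "a \<in> A (Suc i)"
      then obtain x where x: "x \<in> E" "a = nat \<lfloor>x * real q ^ Suc i\<rfloor>" by (auto simp: A_def)
      have "\<lfloor>x * real q ^ i\<rfloor> = \<lfloor>(x * real q ^ Suc i) / real_of_int (int q)\<rfloor>"
        using q by simp
      also have "\<dots> = \<lfloor>x * real q ^ Suc i\<rfloor> div int q" by (rule floor_divide_real_eq_div) simp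
      finally have "nat \<lfloor>x * real q ^ i\<rfloor> = nat (\<lfloor>x * real q ^ Suc i\<rfloor> div int q)" by simp
      moreover have "0 \<le> \<lfloor>x * real q ^ Suc i\<rfloor>" using x E by auto
      ultimately have "nat \<lfloor>x * real q ^ i\<rfloor> = a div q"
        unfolding x(2) by (simp only: nat_div_distrib nat_int)
      then have "a div q \<in> A i" using x(1) unfolding A_def by (metis imageI)
      moreover have "a mod q \<noteq> d (a div q)"
        using d(2)[OF x(1), of "a div q"] x(2) by (metis div_mult_mod_eq)
      ultimately have "(a div q, a mod q) \<in> T" using q by (simp add: T_def)
      then show "a \<in> (\<lambda>(k, j). k * q + j) ` T" by (rule rev_image_eqI) simp
    qed
    have finT: "finite T" using fin by (simp add: T_def)
    have "card T = (\<Sum>k\<in>A i. card ({..<q} - {d k}))"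
      unfolding T_def using fin by (intro card_SigmaI) auto
    also have "\<dots> = card (A i) * (q - 1)" using d(1) by simp
    finally have "card (A (Suc i)) \<le> card (A i) * (q - 1)"
      using card_mono[OF finite_imageI[OF finT] sub] card_image_le[OF finT, of "\<lambda>(k, j). k * q + j"]
      by linarith
    also have "\<dots> \<le> (q - 1) ^ Suc i" using ca by (simp add: mult.commute)
    finally show ?case using finite_subset[OF sub finite_imageI[OF finT]] by simp
  qed
  define I where "I k = {real k / real q ^ J..<(real k + 1) / real q ^ J}" for k
  have qJ: "0 < real q ^ J" using q by simp
  have sub: "E \<subseteq> (\<Union>k\<in>A J. I k)"
  proof
    fix x assume x: "x \<in> E"
    then have "0 \<le> x * real q ^ J" using E qJ by auto
    then have "real (nat \<lfloor>x * real q ^ J\<rfloor>) \<le> x * real q ^ J"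
        "x * real q ^ J < real (nat \<lfloor>x * real q ^ J\<rfloor>) + 1"
      by linarith+
    then have "x \<in> I (nat \<lfloor>x * real q ^ J\<rfloor>)"
      using qJ by (simp add: I_def divide_le_eq less_divide_eq)
    then show "x \<in> (\<Union>k\<in>A J. I k)" using x by (auto simp: A_def)
  qed
  have mI: "measure lebesgue (I k) = 1 / real q ^ J" for k
    using qJ by (simp add: I_def divide_right_mono flip: diff_divide_distrib)
  have lI: "I k \<in> lmeasurable" for k
    unfolding I_def by (intro bounded_set_imp_lmeasurable) auto
  have "measure lebesgue E \<le> measure lebesgue (\<Union>k\<in>A J. I k)"
    \<comment> \<open>A non-measurable set has \<open>measure\<close> zero by convention.\<close>
  proof (cases "E \<in> sets lebesgue")
    case True
    then show ?thesis
      using sub lI card_A[of J] by (intro measure_mono_fmeasurable fmeasurable.finite_UN) auto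
  qed (simp add: measure_notin_sets)
  also have "\<dots> \<le> (\<Sum>k\<in>A J. measure lebesgue (I k))"
    using card_A[of J] lI by (intro measure_UNION_le) (auto simp: fmeasurableD)
  also have "\<dots> = real (card (A J)) / real q ^ J" by (simp add: mI)
  also have "\<dots> \<le> real ((q - 1) ^ J) / real q ^ J"
    using card_A[of J] qJ by (intro divide_right_mono) (auto simp flip: of_nat_power)
  also have "\<dots> = (1 - 1 / real q) ^ J"
    using q by (simp add: of_nat_diff power_divide[symmetric] diff_divide_distrib)
  finally show ?thesis .
qed

section \<open>Renormalising the Weierstrass function\<close>

lemma poly_affine_power_series:
  fixes P :: "real poly"
  assumes "degree P < N"
  shows "\<exists>b. (\<forall>j\<ge>N. b j = 0) \<and> (\<forall>h. (\<lambda>j. b j * h ^ j) sums poly P (u + v * h))"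
proof -
  define Q where "Q = P \<circ>\<^sub>p [:u, v:]"
  have "degree Q \<le> degree P * degree [:u, v:]" unfolding Q_def by (rule degree_pcompose_le)
  also have "\<dots> \<le> degree P" by simp
  finally have deg: "degree Q < N" using assms by simp
  have "(\<lambda>j. coeff Q j * h ^ j) sums poly P (u + v * h)" for h
  proof -
    have "(\<lambda>j. coeff Q j * h ^ j) sums (\<Sum>j\<le>degree Q. coeff Q j * h ^ j)"
      by (rule sums_finite) (auto simp: coeff_eq_0)
    also have "(\<Sum>j\<le>degree Q. coeff Q j * h ^ j) = poly Q h" by (rule poly_altdef[symmetric])
    also have "\<dots> = poly P (u + v * h)" by (simp add: Q_def poly_pcompose mult.commute)
    finally show ?thesis .
  qed
  then show ?thesis using deg by (intro exI[of _ "coeff Q"]) (auto simp: coeff_eq_0)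
qed

locale weierstrass_series =
  fixes \<phi> :: "real \<Rightarrow> real" and \<mu> :: real and l :: nat and M R :: real
  assumes \<mu>: "0 < \<mu>" "\<mu> < 1" and l: "2 \<le> l" and MR: "0 < M" "0 < R"
    and per: "\<And>x. \<phi> (x + 1) = \<phi> x"
    and power_series: "\<And>x. \<exists>c. (\<forall>j. \<bar>c j\<bar> \<le> M * R ^ j) \<and>
      (\<forall>h. \<bar>h\<bar> * R < 1 \<longrightarrow> (\<lambda>j. c j * h ^ j) sums \<phi> (x + h))"
begin

abbreviation "W \<equiv> weierstrass_fun \<phi> \<mu> l"

lemma analytic_phi: "\<exists>F. (\<lambda>h. \<phi> (x + h)) has_fps_expansion F"
proof -
  obtain c where c: "\<And>h. \<bar>h\<bar> * R < 1 \<Longrightarrow> (\<lambda>j. c j * h ^ j) sums \<phi> (x + h)"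
    using power_series[of x] by blast
  show ?thesis unfolding has_fps_expansion_iff_sums
    using c MR by (intro exI[of _ c] exI[of _ "1 / R"]) (auto simp: field_simps)
qed

lemma continuous_phi: "continuous_on A \<phi>"
proof -
  have "isCont \<phi> x" for x
  proof -
    obtain F where "(\<lambda>h. \<phi> (x + h)) has_fps_expansion F" using analytic_phi by blast
    then have "isCont (\<lambda>h. \<phi> (x + h)) 0" using has_fps_expansion_imp_continuous by blast
    then show ?thesis by (simp add: isCont_def LIM_offset_zero_iff)
  qed
  then show ?thesis by (simp add: continuous_at_imp_continuous_on)
qed

lemma abs_phi_le: "\<bar>\<phi> x\<bar> \<le> M"
proof -
  obtain c where c: "\<And>j. \<bar>c j\<bar> \<le> M * R ^ j" "\<And>h. \<bar>h\<bar> * R < 1 \<Longrightarrow> (\<lambda>j. c j * h ^ j) sums \<phi> (x + h)"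
    using power_series[of x] by blast
  have "c 0 = \<phi> x" using c(2)[of 0] powser_sums_zero[of c] by (simp add: sums_unique2)
  then show ?thesis using c(1)[of 0] by simp
qed

lemma phi_add_nat: "\<phi> (x + real k) = \<phi> x"
proof (induction k)
  case (Suc k)
  then show ?case using per[of "x + real k"] by (simp add: add_ac)
qed simp

lemma term_bound: "norm (\<mu> ^ n * \<phi> (real l ^ n * x)) \<le> M * \<mu> ^ n"
  using abs_phi_le \<mu> by (simp add: abs_mult mult.commute)

lemma summable_bound: "summable (\<lambda>n. M * \<mu> ^ n)"
  using \<mu> by (intro summable_mult summable_geometric) auto

lemma W_sums: "(\<lambda>n. \<mu> ^ n * \<phi> (real l ^ n * x)) sums W x"
  unfolding weierstrass_fun_def
  by (intro summable_sums summable_comparison_test'[OF summable_bound] term_bound)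

lemma W_rec: "W x = \<phi> x + \<mu> * W (real l * x)"
proof -
  have "(\<lambda>n. \<mu> * (\<mu> ^ n * \<phi> (real l ^ n * (real l * x)))) sums (\<mu> * W (real l * x))"
    by (intro sums_mult W_sums)
  then have "(\<lambda>n. \<mu> ^ Suc n * \<phi> (real l ^ Suc n * x)) sums (\<mu> * W (real l * x))"
    by (simp add: mult_ac)
  from sums_Suc[OF this] show ?thesis
    using W_sums[of x] by (simp add: sums_unique2 add.commute)
qed

lemma W_add_nat: "W (x + real k) = W x"
proof -
  have "\<phi> (real l ^ n * (x + real k)) = \<phi> (real l ^ n * x)" for n
    using phi_add_nat[of "real l ^ n * x" "l ^ n * k"] by (simp add: distrib_left)
  then show ?thesis by (simp add: weierstrass_fun_def)
qed

lemma continuous_W: "continuous_on A W"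
proof -
  have "uniform_limit A (\<lambda>n x. \<Sum>i<n. \<mu> ^ i * \<phi> (real l ^ i * x)) W sequentially"
    unfolding weierstrass_fun_def by (rule Weierstrass_m_test[OF term_bound summable_bound])
  then show ?thesis
    by (rule uniform_limit_theorem[rotated])
       (intro always_eventually allI continuous_intros trivial_limit_sequentially
          continuous_on_compose2[OF continuous_phi[of UNIV]] subset_UNIV)+
qed

text \<open>
  Iterating the functional equation once more adds \<open>\<phi> ((k + y + h) / l ^ n) / \<mu> ^ n\<close>, whose \<open>j\<close>-th
  coefficient gains the factor \<open>(\<mu> * l ^ j) ^ (- n)\<close>. For \<open>j \<ge> N\<close> this is at most the \<open>n\<close>-th
  power of a number below \<open>1\<close>, so the bounds form a convergent geometric sum.
\<close>

lemma renormalised_difference: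
  assumes N: "1 < \<mu> * real l ^ N"
  shows "\<exists>b. (\<forall>j\<ge>N. \<bar>b j\<bar> \<le> M * (\<Sum>i\<in>{1..n}. (1 / (\<mu> * real l ^ N)) ^ i) * R ^ j) \<and>
    (\<forall>h. \<bar>h\<bar> * R < 1 \<longrightarrow>
      (\<lambda>j. b j * h ^ j) sums (W ((real k + y + h) / real l ^ n) / \<mu> ^ n - W (y + h)))"
proof (induction n)
  case 0
  have "W (real k + y + h) = W (y + h)" for h
    using W_add_nat[of "y + h" k] by (simp add: add_ac)
  then show ?case by (intro exI[of _ "\<lambda>_. 0"]) simp
next
  case (Suc n)
  define \<rho> where "\<rho> = 1 / (\<mu> * real l ^ N)"
  define L where "L = real l ^ Suc n"
  have L: "1 \<le> L" unfolding L_def using l by (intro one_le_power) auto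
  obtain b where b: "\<And>j. N \<le> j \<Longrightarrow> \<bar>b j\<bar> \<le> M * (\<Sum>i\<in>{1..n}. \<rho> ^ i) * R ^ j"
      "\<And>h. \<bar>h\<bar> * R < 1 \<Longrightarrow>
        (\<lambda>j. b j * h ^ j) sums (W ((real k + y + h) / real l ^ n) / \<mu> ^ n - W (y + h))"
    using Suc unfolding \<rho>_def by blast
  obtain c where c: "\<And>j. \<bar>c j\<bar> \<le> M * R ^ j"
      "\<And>h. \<bar>h\<bar> * R < 1 \<Longrightarrow> (\<lambda>j. c j * h ^ j) sums \<phi> ((real k + y) / L + h)"
    using power_series by blast
  define b' where "b' j = b j + c j / (\<mu> ^ Suc n * L ^ j)" for j
  have bnd: "\<bar>b' j\<bar> \<le> M * (\<Sum>i\<in>{1..Suc n}. \<rho> ^ i) * R ^ j" if "N \<le> j" for j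
  proof -
    have "\<mu> * real l ^ N \<le> \<mu> * real l ^ j"
      using that l \<mu> by (intro mult_left_mono power_increasing) auto
    then have "(\<mu> * real l ^ N) ^ Suc n \<le> (\<mu> * real l ^ j) ^ Suc n"
      using N by (intro power_mono) auto
    also have "\<dots> = \<mu> ^ Suc n * L ^ j"
      by (simp only: L_def power_mult_distrib power_mult[symmetric] mult.commute)
    finally have "\<bar>c j\<bar> / (\<mu> ^ Suc n * L ^ j) \<le> M * R ^ j / (\<mu> * real l ^ N) ^ Suc n"
      using c(1)[of j] N MR by (intro frac_le) auto
    then have "\<bar>c j / (\<mu> ^ Suc n * L ^ j)\<bar> \<le> M * \<rho> ^ Suc n * R ^ j"
      using \<mu> L by (simp add: \<rho>_def power_divide abs_mult)
    then have "\<bar>b' j\<bar> \<le> M * (\<Sum>i\<in>{1..n}. \<rho> ^ i) * R ^ j + M * \<rho> ^ Suc n * R ^ j"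
      unfolding b'_def using b(1)[OF that] by linarith
    then show ?thesis by (simp add: algebra_simps)
  qed
  have sums: "(\<lambda>j. b' j * h ^ j) sums (W ((real k + y + h) / L) / \<mu> ^ Suc n - W (y + h))"
    if h: "\<bar>h\<bar> * R < 1" for h
  proof -
    have "\<bar>h / L\<bar> * R \<le> \<bar>h\<bar> * R"
      using L MR by (intro mult_right_mono) (auto simp: divide_le_eq mult_le_cancel_left1)
    then have "(\<lambda>j. c j * (h / L) ^ j) sums \<phi> ((real k + y) / L + h / L)"
      using h by (intro c(2)) linarith
    then have "(\<lambda>j. 1 / \<mu> ^ Suc n * (c j * (h / L) ^ j)) sums
        (1 / \<mu> ^ Suc n * \<phi> ((real k + y + h) / L))"
      by (intro sums_mult) (simp add: add_divide_distrib)
    from sums_add[OF b(2)[OF h] this]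
    have "(\<lambda>j. b' j * h ^ j) sums (W ((real k + y + h) / real l ^ n) / \<mu> ^ n - W (y + h) +
        1 / \<mu> ^ Suc n * \<phi> ((real k + y + h) / L))"
      by (simp add: b'_def power_divide algebra_simps)
    moreover have "real l * ((real k + y + h) / L) = (real k + y + h) / real l ^ n"
      using l by (simp add: L_def)
    then have "W ((real k + y + h) / L) / \<mu> ^ Suc n =
        W ((real k + y + h) / real l ^ n) / \<mu> ^ n + 1 / \<mu> ^ Suc n * \<phi> ((real k + y + h) / L)"
      using W_rec[of "(real k + y + h) / L"] \<mu> by (simp add: add_divide_distrib)
    ultimately show ?thesis by (simp add: algebra_simps)
  qed
  show ?case
    using bnd sums unfolding L_def \<rho>_def by (intro exI[of _ b']) blast
qed

text \<open>
  The renormalised picture describes \<open>W\<close> on the unit interval only, so a two-sided neighbourhood of the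
  non-analytic point must fit inside. A non-analytic point at an integer is moved to its preimage
  \<open>1 / l\<close> under multiplication by \<open>l\<close>, where \<open>W\<close> is non-analytic as well by the functional equation.
\<close>

lemma nonanalytic_interior_point:
  assumes "\<not> W real_analytic_on UNIV"
  obtains y where "0 < y" "y < 1" "\<nexists>F. (\<lambda>h. W (y + h)) has_fps_expansion F"
proof -
  obtain x where x: "\<nexists>F. (\<lambda>h. W (x + h)) has_fps_expansion F"
    using assms by (auto simp: real_analytic_on_def)
  interpret periodic_fun_simple' W
    by standard (use W_add_nat[of _ 1] in simp)
  have "W (frac x + h) = W (x + h)" for h
    using plus_of_int[of "frac x + h" "\<lfloor>x\<rfloor>"] by (simp add: frac_def algebra_simps)
  then have y0: "\<nexists>F. (\<lambda>h. W (frac x + h)) has_fps_expansion F" using x by simp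
  show ?thesis
  proof (cases "frac x = 0")
    case False
    then show ?thesis using that[OF _ _ y0] frac_ge_0[of x] frac_lt_1[of x] by linarith
  next
    case True
    have "\<nexists>F. (\<lambda>h. W (1 / real l + h)) has_fps_expansion F"
    proof
      assume "\<exists>F. (\<lambda>h. W (1 / real l + h)) has_fps_expansion F"
      then obtain F G where "(\<lambda>h. W (1 / real l + h)) has_fps_expansion F"
          "(\<lambda>h. \<phi> (1 / real l + h)) has_fps_expansion G"
        using analytic_phi by blast
      then have "(\<lambda>h. W (1 / real l + h) - \<phi> (1 / real l + h)) has_fps_expansion (F - G)"
        by (rule has_fps_expansion_diff)
      then have "\<exists>F. (\<lambda>h. W (1 / real l + h) - \<phi> (1 / real l + h)) has_fps_expansion F" by blast
      then obtain c r where r: "0 < r" and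
          c: "\<And>h. \<bar>h\<bar> < r \<Longrightarrow> (\<lambda>j. c j * h ^ j) sums (W (1 / real l + h) - \<phi> (1 / real l + h))"
        unfolding has_fps_expansion_iff_sums by blast
      have eq: "W (1 / real l + h / real l) - \<phi> (1 / real l + h / real l) = \<mu> * W (frac x + h)" for h
        using W_rec[of "1 / real l + h / real l"] W_add_nat[of h 1] l unfolding True
        by (simp add: distrib_left add.commute)
      have "(\<lambda>j. (c j / real l ^ j / \<mu>) * h ^ j) sums W (frac x + h)" if "\<bar>h\<bar> < r * real l" for h
      proof -
        have "(\<lambda>j. c j * (h / real l) ^ j) sums (\<mu> * W (frac x + h))"
          unfolding eq[symmetric] using that l by (intro c) (simp add: divide_less_eq)
        from sums_mult[OF this, of "1 / \<mu>"] show ?thesis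
          using \<mu> by (simp add: power_divide field_simps)
      qed
      then have "\<exists>F. (\<lambda>h. W (frac x + h)) has_fps_expansion F"
        unfolding has_fps_expansion_iff_sums using r l
        by (intro exI[of _ "\<lambda>j. c j / real l ^ j / \<mu>"] exI[of _ "r * real l"]) auto
      then show False using y0 by blast
    qed
    then show ?thesis using that[of "1 / real l"] l by simp
  qed
qed

text \<open>
  After scaling by \<open>\<mu> ^ (- n)\<close>, the difference of \<open>W\<close> and \<open>P\<close> on the \<open>k\<close>-th interval of level \<open>n\<close> is
  \<open>W\<close> minus a power series to which \<open>uniform_gap\<close> applies. The interval of length \<open>d\<close>
  obtained there contains an \<open>l\<close>-adic interval of level \<open>m\<close>, because \<open>l ^ m \<ge> 2 / d\<close>.
\<close>

lemma free_subinterval: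
  assumes N: "1 < \<mu> * real l ^ N" and nonanalytic: "\<not> W real_analytic_on UNIV"
  obtains \<tau> m where "0 < \<tau>" "1 \<le> m"
    "\<And>n k P. degree P < N \<Longrightarrow> \<exists>j<l ^ m. \<forall>y. real j / real l ^ m \<le> y \<and> y < (real j + 1) / real l ^ m \<longrightarrow>
      \<tau> * \<mu> ^ n < \<bar>W ((real k + y) / real l ^ n) - poly P ((real k + y) / real l ^ n)\<bar>"
proof -
  obtain y0 where y0: "0 < y0" "y0 < 1" "\<nexists>F. (\<lambda>h. W (y0 + h)) has_fps_expansion F"
    using nonanalytic_interior_point[OF nonanalytic] by blast
  define \<rho> where "\<rho> = 1 / (\<mu> * real l ^ N)"
  have \<rho>: "0 < \<rho>" "\<rho> < 1" using N by (auto simp: \<rho>_def)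
  define B where "B = M / (1 - \<rho>)"
  have B: "0 < B" using MR \<rho> by (simp add: B_def)
  define r where "r = min (1 / (2 * R)) (min y0 (1 - y0))"
  have r: "0 < r" "r \<le> y0" "r \<le> 1 - y0" "r \<le> 1 / (2 * R)" using y0 MR by (auto simp: r_def)
  have rR: "r * R < 1"
    using mult_right_mono[OF r(4), of R] MR by simp
  have cont: "continuous_on {-r..r} (\<lambda>h. W (y0 + h))"
    by (rule continuous_on_compose2[OF continuous_W[of UNIV]]) (auto intro!: continuous_intros)
  obtain \<tau> \<delta> where \<tau>: "0 < \<tau>" and \<delta>: "0 < \<delta>" and gap:
    "\<And>b. (\<And>j. N \<le> j \<Longrightarrow> \<bar>b j\<bar> \<le> B * R ^ j) \<Longrightarrow>
      \<exists>h0\<in>{-r..r}. \<forall>h\<in>{-r..r}. \<bar>h - h0\<bar> < \<delta> \<longrightarrow> \<tau> < \<bar>W (y0 + h) - (\<Sum>j. b j * h ^ j)\<bar>"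
  proof (rule uniform_gap[OF B MR(2) r(1) rR cont y0(3), where N = N], goal_cases)
    case (1 \<tau> \<delta>)
    show ?case by (rule 1(1)[OF 1(2,3)]) (rule 1(4))
  qed
  define d where "d = min \<delta> r / 2"
  have d: "0 < d" "d < \<delta>" "d < r" using \<delta> r by (auto simp: d_def)
  obtain m0 where m0: "(1/2) ^ m0 < d / 2"
    using real_arch_pow_inv[of "d/2" "1/2"] d by auto
  define m where "m = Suc m0"
  have q: "2 / real l ^ m \<le> d"
  proof -
    have "(2::real) ^ m0 \<le> 2 ^ m" by (simp add: m_def)
    also have "\<dots> \<le> real l ^ m" using l by (intro power_mono) auto
    finally have "2 / real l ^ m \<le> 2 / 2 ^ m0" using l by (intro divide_left_mono) auto
    also have "\<dots> < d" using m0 by (simp add: power_divide)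
    finally show ?thesis by simp
  qed
  show ?thesis
  proof (rule that[OF \<tau>, of m])
    show "1 \<le> m" by (simp add: m_def)
    fix n k :: nat and P :: "real poly"
    assume P: "degree P < N"
    obtain b where b: "\<And>j. N \<le> j \<Longrightarrow> \<bar>b j\<bar> \<le> M * (\<Sum>i\<in>{1..n}. \<rho> ^ i) * R ^ j"
        "\<And>h. \<bar>h\<bar> * R < 1 \<Longrightarrow>
          (\<lambda>j. b j * h ^ j) sums (W ((real k + y0 + h) / real l ^ n) / \<mu> ^ n - W (y0 + h))"
      using renormalised_difference[OF N, of n k y0] unfolding \<rho>_def by blast
    obtain p where p: "\<And>j. N \<le> j \<Longrightarrow> p j = 0"
        "\<And>h. (\<lambda>j. p j * h ^ j) sums poly P ((real k + y0) / real l ^ n + 1 / real l ^ n * h)"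
      using poly_affine_power_series[OF P] by blast
    define a where "a j = p j / \<mu> ^ n - b j" for j
    have a_bound: "\<bar>a j\<bar> \<le> B * R ^ j" if "N \<le> j" for j
    proof -
      have "(\<Sum>i\<in>{1..n}. \<rho> ^ i) \<le> (\<Sum>i. \<rho> ^ i)"
        using \<rho> by (intro sum_le_suminf summable_geometric) auto
      also have "\<dots> = 1 / (1 - \<rho>)" using \<rho> by (simp add: suminf_geometric)
      finally have "M * (\<Sum>i\<in>{1..n}. \<rho> ^ i) * R ^ j \<le> M * (1 / (1 - \<rho>)) * R ^ j"
        using MR by (intro mult_right_mono mult_left_mono) auto
      then show ?thesis using b(1)[OF that] p(1)[OF that] by (simp add: a_def B_def)
    qed
    have a_sum: "W (y0 + h) - (\<Sum>j. a j * h ^ j) =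
        (W ((real k + (y0 + h)) / real l ^ n) - poly P ((real k + (y0 + h)) / real l ^ n)) / \<mu> ^ n"
      if "h \<in> {-r..r}" for h
    proof -
      have "\<bar>h\<bar> * R \<le> r * R" using that MR by (intro mult_right_mono) auto
      then have h: "\<bar>h\<bar> * R < 1" using rR by simp
      from sums_diff[OF sums_mult[OF p(2)[of h], of "1 / \<mu> ^ n"] b(2)[OF h]]
      have "(\<lambda>j. a j * h ^ j) sums (1 / \<mu> ^ n * poly P ((real k + (y0 + h)) / real l ^ n) -
          (W ((real k + (y0 + h)) / real l ^ n) / \<mu> ^ n - W (y0 + h)))"
        by (simp add: a_def algebra_simps add_divide_distrib)
      then have "(\<Sum>j. a j * h ^ j) = 1 / \<mu> ^ n * poly P ((real k + (y0 + h)) / real l ^ n) -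
          (W ((real k + (y0 + h)) / real l ^ n) / \<mu> ^ n - W (y0 + h))"
        by (rule sums_unique[symmetric])
      then show ?thesis by (simp add: diff_divide_distrib)
    qed
    obtain h0 where h0: "h0 \<in> {-r..r}"
        "\<And>h. h \<in> {-r..r} \<Longrightarrow> \<bar>h - h0\<bar> < \<delta> \<Longrightarrow> \<tau> < \<bar>W (y0 + h) - (\<Sum>j. a j * h ^ j)\<bar>"
      using gap[of a] a_bound by blast
    \<comment> \<open>The interval is laid from \<open>h0\<close> towards the centre, so that it cannot leave \<open>{-r..r}\<close>.\<close>
    define s where "s = (if h0 \<le> 0 then h0 else h0 - d)"
    have s: "\<And>h. s \<le> h \<Longrightarrow> h \<le> s + d \<Longrightarrow> h \<in> {-r..r} \<and> \<bar>h - h0\<bar> < \<delta>"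
      "-r \<le> s" "s + d \<le> r"
      using h0(1) d r(1) by (auto simp: s_def split: if_splits)
    define Q where "Q = real l ^ m"
    have Q: "0 < Q" using l by (simp add: Q_def)
    define j where "j = nat \<lceil>(y0 + s) * Q\<rceil>"
    have "0 \<le> (y0 + s) * Q" using s(2) r Q by simp
    then have j: "(y0 + s) * Q \<le> real j" "real j < (y0 + s) * Q + 1"
      unfolding j_def by linarith+
    have j1: "y0 + s \<le> real j / Q" using j(1) Q by (simp add: le_divide_eq)
    have "(real j + 1) / Q < ((y0 + s) * Q + 2) / Q" using j(2) Q by (intro divide_strict_right_mono) auto
    also have "\<dots> = y0 + s + 2 / Q" using Q by (simp add: add_divide_distrib)
    also have "\<dots> \<le> y0 + s + d" using q by (simp add: Q_def)
    finally have j2: "(real j + 1) / Q \<le> y0 + s + d" by simp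
    also have "\<dots> \<le> 1" using s(3) r by simp
    finally have "real j + 1 \<le> real l ^ m" using Q by (simp add: divide_le_eq Q_def)
    then have "real (j + 1) \<le> real (l ^ m)" by simp
    then have "j < l ^ m" by (simp only: of_nat_le_iff)
    moreover have "\<tau> * \<mu> ^ n < \<bar>W ((real k + y) / real l ^ n) - poly P ((real k + y) / real l ^ n)\<bar>"
      if y: "real j / Q \<le> y" "y < (real j + 1) / Q" for y
    proof -
      have h: "y - y0 \<in> {-r..r}" "\<bar>y - y0 - h0\<bar> < \<delta>"
        using s(1)[of "y - y0"] y j1 j2 by auto
      show ?thesis
        using h0(2)[OF h] unfolding a_sum[OF h(1)] using \<mu>
        by (simp add: abs_mult less_divide_eq)
    qed
    ultimately show "\<exists>j<l ^ m. \<forall>y. real j / real l ^ m \<le> y \<and> y < (real j + 1) / real l ^ m \<longrightarrow>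
      \<tau> * \<mu> ^ n < \<bar>W ((real k + y) / real l ^ n) - poly P ((real k + y) / real l ^ n)\<bar>"
      unfolding Q_def by blast
  qed
qed

text \<open>
  The exponent is chosen such that \<open>(\<mu> ^ m) powr \<gamma> = 1 - 1 / l ^ m\<close>: refining by \<open>m\<close> levels
  multiplies the threshold \<open>\<tau> * \<mu> ^ n\<close> by \<open>\<mu> ^ m\<close> and the measure of the cover by
  \<open>1 - 1 / l ^ m\<close>.
\<close>

lemma sublevel_measure_bound:
  assumes N: "1 < \<mu> * real l ^ N" and nonanalytic: "\<not> W real_analytic_on UNIV"
  obtains \<gamma> C \<sigma>\<^sub>0 where "0 < \<gamma>" "0 < C" "0 < \<sigma>\<^sub>0"
    "\<And>\<sigma> P. 0 < \<sigma> \<Longrightarrow> \<sigma> < \<sigma>\<^sub>0 \<Longrightarrow> degree P < N \<Longrightarrow>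
      measure lebesgue {x \<in> {0..<1}. \<bar>W x - poly P x\<bar> \<le> \<sigma>} \<le> C * \<sigma> powr \<gamma>"
proof -
  obtain \<tau> m where \<tau>: "0 < \<tau>" and m: "1 \<le> m" and free:
    "\<And>n k P. degree P < N \<Longrightarrow> \<exists>j<l ^ m. \<forall>y. real j / real l ^ m \<le> y \<and> y < (real j + 1) / real l ^ m \<longrightarrow>
      \<tau> * \<mu> ^ n < \<bar>W ((real k + y) / real l ^ n) - poly P ((real k + y) / real l ^ n)\<bar>"
    using free_subinterval[OF N nonanalytic] by blast
  define q where "q = l ^ m"
  have "l ^ 1 \<le> q" unfolding q_def using l m by (intro power_increasing) auto
  then have q: "2 \<le> q" using l by simp
  have \<mu>m: "0 < \<mu> ^ m" "\<mu> ^ m < 1" using \<mu> m by (auto simp: power_less_one_iff)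
  define \<gamma> where "\<gamma> = ln (1 - 1 / real q) / ln (\<mu> ^ m)"
  have q1: "0 < 1 - 1 / real q" "1 - 1 / real q < 1" using q by auto
  have "ln (1 - 1 / real q) < 0" "ln (\<mu> ^ m) < 0"
    using q1 \<mu>m by (auto simp only: ln_less_zero)
  then have \<gamma>: "0 < \<gamma>" unfolding \<gamma>_def by (rule divide_neg_neg)
  have "\<gamma> * ln (\<mu> ^ m) = ln (1 - 1 / real q)"
    using \<open>ln (\<mu> ^ m) < 0\<close> unfolding \<gamma>_def by (metis less_irrefl nonzero_eq_divide_eq)
  then have base: "(\<mu> ^ m) powr \<gamma> = 1 - 1 / real q"
    using q1(1) \<mu>m(1) by (metis exp_ln less_irrefl powr_def)
  show ?thesis
  proof (rule that[OF \<gamma> _ \<tau>, of "\<tau> powr (- \<gamma>)"])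
    show "0 < \<tau> powr (- \<gamma>)" using \<tau> by simp
    fix \<sigma> :: real and P :: "real poly"
    assume \<sigma>: "0 < \<sigma>" "\<sigma> < \<tau>" and P: "degree P < N"
    define E where "E = {x \<in> {0..<1}. \<bar>W x - poly P x\<bar> \<le> \<sigma>}"
    have "\<exists>J. \<tau> * (\<mu> ^ m) ^ J < \<sigma>"
    proof -
      obtain J where "(\<mu> ^ m) ^ J < \<sigma> / \<tau>"
        using real_arch_pow_inv[of "\<sigma> / \<tau>" "\<mu> ^ m"] \<sigma> \<tau> \<mu>m by auto
      then show ?thesis using \<tau> by (auto simp: field_simps)
    qed
    \<comment> \<open>\<open>J\<close> counts the refinements for which the threshold still dominates \<open>\<sigma>\<close>.\<close>
    define J where "J = (LEAST J. \<tau> * (\<mu> ^ m) ^ J < \<sigma>)"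
    have J: "\<tau> * (\<mu> ^ m) ^ J < \<sigma>"
      unfolding J_def by (rule LeastI_ex) fact
    have J_least: "\<sigma> \<le> \<tau> * (\<mu> ^ m) ^ i" if "i < J" for i
      using not_less_Least[OF that[unfolded J_def]] by simp
    have "measure lebesgue E \<le> (1 - 1 / real q) ^ J"
    proof (rule measure_le_of_missing_digits[OF _ q])
      show "E \<subseteq> {0..<1}" by (auto simp: E_def)
      fix i k assume i: "i < J"
      obtain j where j: "j < l ^ m" "\<And>y. real j / real l ^ m \<le> y \<Longrightarrow> y < (real j + 1) / real l ^ m \<Longrightarrow>
          \<tau> * \<mu> ^ (m * i) < \<bar>W ((real k + y) / real l ^ (m * i)) - poly P ((real k + y) / real l ^ (m * i))\<bar>"
        using free[OF P] by blast
      have "nat \<lfloor>x * real q ^ Suc i\<rfloor> \<noteq> k * q + j" if x: "x \<in> E" for x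
      proof
        assume eq: "nat \<lfloor>x * real q ^ Suc i\<rfloor> = k * q + j"
        have "0 \<le> x * real q ^ Suc i" using x by (simp add: E_def)
        then have fl: "real (k * q + j) \<le> x * real q ^ Suc i" "x * real q ^ Suc i < real (k * q + j) + 1"
          unfolding eq[symmetric] by linarith+
        define y where "y = x * real q ^ i - real k"
        have "real j / real q \<le> y" "y < (real j + 1) / real q"
          using fl q by (auto simp: y_def field_simps)
        moreover have "real l ^ (m * i) = real q ^ i" by (simp add: q_def power_mult)
        moreover have "(real k + y) / real q ^ i = x" using q by (simp add: y_def)
        ultimately have "\<tau> * (\<mu> ^ m) ^ i < \<bar>W x - poly P x\<bar>"
          using j(2)[of y] by (simp add: q_def power_mult)
        then show False using J_least[OF i] x by (simp add: E_def)
      qed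
      then show "\<exists>j<q. \<forall>x\<in>E. nat \<lfloor>x * real q ^ Suc i\<rfloor> \<noteq> k * q + j"
        using j(1) unfolding q_def by blast
    qed
    also have "\<dots> = ((\<mu> ^ m) ^ J) powr \<gamma>"
      using \<mu>m q1 by (simp add: powr_power base[symmetric] powr_realpow[symmetric] powr_powr mult.commute del: power_mult)
    also have "\<dots> \<le> (\<sigma> / \<tau>) powr \<gamma>"
      using J \<tau> \<gamma> \<mu>m by (intro powr_mono2) (auto simp: field_simps)
    also have "\<dots> = \<tau> powr (- \<gamma>) * \<sigma> powr \<gamma>"
      using \<sigma> \<tau> by (simp add: powr_divide powr_minus_divide)
    finally show "measure lebesgue {x \<in> {0..<1}. \<bar>W x - poly P x\<bar> \<le> \<sigma>} \<le> \<tau> powr (- \<gamma>) * \<sigma> powr \<gamma>"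
      unfolding E_def .
  qed
qed

end

theorem theoremB15:
  fixes \<phi> :: "real \<Rightarrow> real" and \<mu> :: real and l N :: nat
  assumes "\<phi> real_analytic_on UNIV"
    and "\<not> \<phi> constant_on UNIV"
    and "\<And>x. \<phi> (x + 1) = \<phi> x"
    and "0 < \<mu>" and "\<mu> < 1"
    and "2 \<le> l"
    and "N = (LEAST n. 1 \<le> n \<and> \<mu> * real l ^ n > 1)"
    and "\<not> weierstrass_fun \<phi> \<mu> l real_analytic_on UNIV"
  shows "\<exists>\<gamma>>0. \<exists>C>0. \<exists>\<sigma>\<^sub>0>0. \<forall>\<sigma>. 0 < \<sigma> \<and> \<sigma> < \<sigma>\<^sub>0 \<longrightarrow>
    (\<forall>P :: real poly. degree P \<le> N - 1 \<longrightarrow>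
      measure lebesgue {\<theta> \<in> {0..<1}. \<bar>weierstrass_fun \<phi> \<mu> l \<theta> - poly P \<theta>\<bar> \<le> \<sigma>}
        \<le> C * \<sigma> powr \<gamma>)"
proof -
  obtain M R where MR: "0 < M" "0 < R" "\<And>x. \<exists>c. (\<forall>j. \<bar>c j\<bar> \<le> M * R ^ j) \<and>
      (\<forall>h. \<bar>h\<bar> * R < 1 \<longrightarrow> (\<lambda>j. c j * h ^ j) sums \<phi> (x + h))"
    using uniform_power_series_bounds[OF assms(1,3)] by blast
  interpret weierstrass_series \<phi> \<mu> l M R
    by standard (use assms MR in auto)
  have "\<exists>n. 1 \<le> n \<and> 1 < \<mu> * real l ^ n"
  proof -
    obtain n where n: "1 / \<mu> < real l ^ n"
      using real_arch_pow[of "real l" "1 / \<mu>"] assms(6) by auto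
    also have "\<dots> \<le> real l ^ Suc n" using assms(6) by (intro power_increasing) auto
    finally show ?thesis using assms(4) by (intro exI[of _ "Suc n"]) (simp add: field_simps)
  qed
  then have "1 \<le> N \<and> 1 < \<mu> * real l ^ N" unfolding assms(7) by (rule LeastI_ex)
  then have N: "1 \<le> N" "1 < \<mu> * real l ^ N" by auto
  obtain \<gamma> C \<sigma>\<^sub>0 where pos: "0 < \<gamma>" "0 < C" "0 < \<sigma>\<^sub>0" and bound:
    "\<And>\<sigma> P. 0 < \<sigma> \<Longrightarrow> \<sigma> < \<sigma>\<^sub>0 \<Longrightarrow> degree P < N \<Longrightarrow>
      measure lebesgue {x \<in> {0..<1}. \<bar>W x - poly P x\<bar> \<le> \<sigma>} \<le> C * \<sigma> powr \<gamma>"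
    using sublevel_measure_bound[OF N(2) assms(8)] by blast
  show ?thesis
  proof (rule exI[of _ \<gamma>], rule conjI[OF pos(1)], rule exI[of _ C], rule conjI[OF pos(2)],
      rule exI[of _ "\<sigma>\<^sub>0"], rule conjI[OF pos(3)], intro allI impI)
    fix \<sigma> :: real and P :: "real poly"
    assume "0 < \<sigma> \<and> \<sigma> < \<sigma>\<^sub>0" "degree P \<le> N - 1"
    then show "measure lebesgue {\<theta> \<in> {0..<1}. \<bar>W \<theta> - poly P \<theta>\<bar> \<le> \<sigma>} \<le> C * \<sigma> powr \<gamma>"
      using N(1) by (intro bound) auto
  qed
qed

end
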